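(* Let $d\ge 1$ and let $X=(X_1,\dots,X_d)$ be a random variable in $\mathbb{R}^d$ generated by a non-linear additive Gaussian noise model $$X_i=f_i(\mathrm{pa}_i(X))+\epsilon_i,\qquad i=1,\dots,d,$$ over a directed acyclic graph $\mathcal{G}$ on $\{1,\dots,d\}$, where $\mathrm{pa}_i(X)$ denotes the sub-vector of $X$ of coordinates that are parents of $i$ in $\mathcal{G}$, the noise variables $\epsilon_i\sim\mathcal{N}(0,\sigma_i^2)$, $\sigma_i>0$, are jointly independent, and each $f_i$ is twice continuously differentiable and non-linear in every component (as defined in the context). Let $p$ be the probability density function of $X$ and let $s(x)=\nabla\log p(x)$ be its score function, with components $s_1,\dots,s_d$. Then for every $j\in\{1,\dots,d\}$: (i) $j$ is a leaf of $\mathcal{G}$ if and only if there is a constant $c\in\mathbb{R}$, independent of $x$, such that $\frac{\partial s_j(x)}{\partial x_j}=c$ for all $x\in\mathbb{R}^d$; equivalently, if and only if $\mathrm{Var}_X\left[\frac{\partial s_j(X)}{\partial x_j}\right]=0$. (ii) If $j$ is a leaf of $\mathcal{G}$, then for every $i\neq j$: $i$ is a parent of $j$ in $\mathcal{G}$ if and only if $s_j(x)$ depends on $x_i$ (functionally, i.e. as a function of $x\in\mathbb{R}^d$); equivalently, if and only if $\mathrm{Var}_X\left[\frac{\partial s_j(X)}{\partial x_i}\right]\neq 0$.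
   Context: A leaf of a directed acyclic graph is a node with no children (no outgoing edges). Non-linear in every component: if the parents of node $j$ are $k_1,\dots,k_l$, then for every $a\in\{1,\dots,l\}$ there exist values $(x_{k_1},\dots,x_{k_{a-1}},x_{k_{a+1}},\dots,x_{k_l})\in\mathbb{R}^{l-1}$ such that the univariate function $t\mapsto f_j(x_{k_1},\dots,x_{k_{a-1}},t,x_{k_{a+1}},\dots,x_{k_l})$ is non-linear, meaning not of the form $t\mapsto \alpha t+\beta$. If $j$ has no parents, $f_j$ is a constant. Convention on variance: for a real random variable $Y$, $\mathrm{Var}[Y]=0$ means that $Y$ is almost surely equal to a constant, and $\mathrm{Var}[Y]\ne 0$ means that it is not (no integrability of $Y$ is presupposed). *)

theory Defs
  imports "HOL-Probability.Probability"
begin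

(* A directed graph on the vertex type 'n is its edge set; (k, j) is the edge from k to j. *)

definition parents :: "('n \<times> 'n) set \<Rightarrow> 'n \<Rightarrow> 'n set" where
  "parents G j = {k. (k, j) \<in> G}"

definition leaf :: "('n \<times> 'n) set \<Rightarrow> 'n \<Rightarrow> bool" where
  "leaf G j \<longleftrightarrow> (\<forall>k. (j, k) \<notin> G)"

definition vec_upd :: "real^'n \<Rightarrow> 'n \<Rightarrow> real \<Rightarrow> real^'n" where
  "vec_upd x i t = (\<chi> k. if k = i then t else x $ k)"

(* A function of the sub-vector with index set S is encoded as a function of the whole
   vector that is determined by the coordinates in S; for S = {} it is a constant. *)
definition function_of_coords :: "'n set \<Rightarrow> (real^'n \<Rightarrow> real) \<Rightarrow> bool" where
  "function_of_coords S g \<longleftrightarrow> (\<forall>x y. (\<forall>k\<in>S. x $ k = y $ k) \<longrightarrow> g x = g y)"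

definition depends_on_coord :: "(real^'n \<Rightarrow> real) \<Rightarrow> 'n \<Rightarrow> bool" where
  "depends_on_coord g i \<longleftrightarrow> (\<exists>x t. g (vec_upd x i t) \<noteq> g x)"

definition twice_continuously_differentiable :: "('a::real_normed_vector \<Rightarrow> real) \<Rightarrow> bool" where
  "twice_continuously_differentiable g \<longleftrightarrow>
     (\<exists>(g' :: 'a \<Rightarrow> 'a \<Rightarrow>\<^sub>L real) (g'' :: 'a \<Rightarrow> 'a \<Rightarrow>\<^sub>L 'a \<Rightarrow>\<^sub>L real).
        (\<forall>x. (g has_derivative blinfun_apply (g' x)) (at x)) \<and>
        (\<forall>x. (g' has_derivative blinfun_apply (g'' x)) (at x)) \<and>
        continuous_on UNIV g'')"

definition nonlinear_in_every_component :: "'n set \<Rightarrow> (real^'n \<Rightarrow> real) \<Rightarrow> bool" where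
  "nonlinear_in_every_component S g \<longleftrightarrow>
     (\<forall>k\<in>S. \<exists>x. \<not> (\<exists>\<alpha> \<beta>. \<forall>t. g (vec_upd x k t) = \<alpha> * t + \<beta>))"

definition gradient :: "('a::real_inner \<Rightarrow> real) \<Rightarrow> 'a \<Rightarrow> 'a" where
  "gradient g x = (THE D. GDERIV g x :> D)"

definition partial_deriv :: "'n \<Rightarrow> (real^'n \<Rightarrow> real) \<Rightarrow> real^'n \<Rightarrow> real" where
  "partial_deriv i g x = deriv (\<lambda>t. g (vec_upd x i t)) (x $ i)"

definition score :: "(real^'n \<Rightarrow> real) \<Rightarrow> real^'n \<Rightarrow> real^'n" where
  "score p = gradient (\<lambda>x. ln (p x))"

(* A density with respect to Lebesgue measure is determined only up to null sets, which is not
   enough to speak of its gradient; continuity singles out one representative. *)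
definition continuous_density :: "'a measure \<Rightarrow> ('a \<Rightarrow> real^'n) \<Rightarrow> (real^'n \<Rightarrow> real) \<Rightarrow> bool" where
  "continuous_density M X p \<longleftrightarrow>
     distributed M lborel X (\<lambda>x. ennreal (p x)) \<and> (\<forall>x. 0 \<le> p x) \<and> continuous_on UNIV p"

(* Unlike variance in the library, which is 0 also when Y is not integrable. *)
definition zero_variance :: "'a measure \<Rightarrow> ('a \<Rightarrow> real) \<Rightarrow> bool" where
  "zero_variance M Y \<longleftrightarrow> (\<exists>c. AE \<omega> in M. Y \<omega> = c)"

end

theory Submission
  imports Defs
begin

text \<open>
  Adding vertices one at a time, each only after all of its children, exhibits the residual map
  \<open>x \<mapsto> (x\<^sub>i - f\<^sub>i(x))\<^sub>i\<close> as a composition of shears, so by Fubini it preserves Lebesgue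
  measure; hence \<open>p(x)\<close> is the product of the Gaussian densities of the residuals
  \<open>x\<^sub>i - f\<^sub>i(x)\<close>, first almost everywhere and then everywhere by continuity. This gives
  \<open>\<partial>\<^sub>j s\<^sub>j = - 1 / \<sigma>\<^sub>j\<^sup>2 + (\<Sum>i \<in> ch(j). (\<partial>\<^sub>j\<^sup>2 f\<^sub>i \<cdot> (x\<^sub>i - f\<^sub>i) - (\<partial>\<^sub>j f\<^sub>i)\<^sup>2) / \<sigma>\<^sub>i\<^sup>2)\<close>.
  If \<open>j\<close> has a child, it has one, \<open>k\<close>, that is not a parent of another child of \<open>j\<close>.
  Then \<open>x\<^sub>k\<close> enters \<open>\<partial>\<^sub>j s\<^sub>j\<close> only through the summand \<open>\<partial>\<^sub>j\<^sup>2 f\<^sub>k \<cdot> x\<^sub>k / \<sigma>\<^sub>k\<^sup>2\<close>, so if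
  \<open>\<partial>\<^sub>j s\<^sub>j\<close> is constant then \<open>\<partial>\<^sub>j\<^sup>2 f\<^sub>k = 0\<close>, contradicting non-linearity. For a leaf,
  \<open>s\<^sub>j = (f\<^sub>j(x) - x\<^sub>j) / \<sigma>\<^sub>j\<^sup>2\<close>, which settles (ii). The variance versions follow because
  \<open>p > 0\<close> and the derivatives of the score are continuous.
\<close>

subsection \<open>Coordinate lines\<close>

lemma vec_upd_alt: "vec_upd x i t = x + (t - x $ i) *\<^sub>R axis i 1"
  by (auto simp: vec_upd_def vec_eq_iff axis_def)

lemma vec_upd_component: "vec_upd x i t $ k = (if k = i then t else x $ k)"
  by (simp add: vec_upd_def)

lemma axis_component: "axis i a $ k = (if k = i then a else 0)"
  by (simp add: axis_def)

lemma vec_upd_measurable [measurable]: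
  fixes g :: "real^'n::finite \<Rightarrow> real"
  assumes [measurable]: "g \<in> borel_measurable borel"
  shows "(\<lambda>x. vec_upd x i (g x)) \<in> borel_measurable borel"
  unfolding vec_upd_alt by measurable

lemma has_derivative_vec_upd: "((\<lambda>t. vec_upd x i t) has_derivative (\<lambda>h. h *\<^sub>R axis i 1)) (at t)"
  unfolding vec_upd_alt by (auto intro!: derivative_eq_intros)

lemma has_field_derivative_vec_upd:
  fixes g :: "real^'n::finite \<Rightarrow> real"
  assumes "(g has_derivative g') (at (vec_upd x i t))"
  shows "((\<lambda>t. g (vec_upd x i t)) has_field_derivative g' (axis i 1)) (at t)"
proof -
  have "linear g'" using assms by (intro bounded_linear.linear has_derivative_bounded_linear)
  then have "(\<lambda>h. g' (h *\<^sub>R axis i 1)) = (*) (g' (axis i 1))"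
    by (auto simp: linear_scale)
  then show ?thesis
    using has_derivative_compose[OF has_derivative_vec_upd assms]
    by (simp add: has_field_derivative_def)
qed

lemma partial_deriv_eq:
  fixes g :: "real^'n::finite \<Rightarrow> real"
  assumes "(g has_derivative g') (at x)"
  shows "partial_deriv i g x = g' (axis i 1)"
proof -
  have "vec_upd x i (x $ i) = x" by (simp add: vec_upd_alt)
  with assms show ?thesis
    unfolding partial_deriv_def by (intro DERIV_imp_deriv has_field_derivative_vec_upd) simp
qed

text \<open>Both maps are derivatives at \<open>x\<close> of one and the same function. Applied to
  \<open>f i\<close> and then to \<open>D i\<close>, this passes the independence of a coordinate on
  to first and second derivatives.\<close>

lemma has_derivative_translation_invariant:
  assumes g: "\<And>x. (g has_derivative g' x) (at x)" and inv: "\<And>x. g (x + v) = g x"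
  shows "g' (x + v) = g' x"
proof -
  have "((\<lambda>x. g (x + v)) has_derivative g' (x + v)) (at x)"
    using g[of "x + v"] by (auto intro!: derivative_eq_intros has_derivative_compose[of "\<lambda>x. x + v" _ x UNIV g])
  then show ?thesis
    using g[of x] unfolding inv by (rule has_derivative_unique)
qed

text \<open>Subtracting \<open>c * t\<close> leaves a function of \<open>t\<close> with zero
  derivative. Non-linearity is always contradicted through this lemma.\<close>

lemma affine_along_coordinate:
  fixes g :: "real^'n::finite \<Rightarrow> real"
  assumes g: "\<And>x. (g has_derivative g' x) (at x)" and c: "\<And>t. g' (vec_upd x i t) (axis i 1) = c"
  shows "\<exists>\<alpha> \<beta>. \<forall>t. g (vec_upd x i t) = \<alpha> * t + \<beta>"
proof -
  have "((\<lambda>t. g (vec_upd x i t) - c * t) has_field_derivative 0) (at t)" for t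
    using has_field_derivative_vec_upd[OF g, of x i t] by (auto intro!: derivative_eq_intros simp: c)
  then have "g (vec_upd x i t) - c * t = g (vec_upd x i 0) - c * 0" for t
    by (intro DERIV_isconst_all) blast
  then have "g (vec_upd x i t) = c * t + g (vec_upd x i 0)" for t
    by (metis add.commute diff_eq_eq diff_zero mult_zero_right)
  then show ?thesis by blast
qed

subsection \<open>Lebesgue measure on cartesian space\<close>

lemma vec_lambda_measurable: "vec_lambda \<in> (\<Pi>\<^sub>M i\<in>(UNIV::'n::finite set). (lborel::real measure)) \<rightarrow>\<^sub>M borel"
proof (rule borel_measurable_euclidean_space[THEN iffD2], intro ballI)
  fix b :: "real^'n" assume "b \<in> Basis"
  then obtain i where b: "b = axis i 1" by (auto simp: Basis_vec_def)
  show "(\<lambda>x. vec_lambda x \<bullet> b) \<in> borel_measurable (\<Pi>\<^sub>M i\<in>(UNIV::'n::finite set). (lborel::real measure))"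
    unfolding b by (simp add: inner_axis, measurable)
qed

text \<open>Lebesgue measure is determined by the volumes of boxes, and a box pulls back under
  \<open>vec_lambda\<close> to a product of intervals. The product form makes Fubini
  available.\<close>

lemma lborel_vec_eq: "(lborel :: (real^'n::finite) measure) = distr (\<Pi>\<^sub>M i\<in>UNIV. lborel) borel vec_lambda"
proof (rule lborel_eqI)
  interpret product_sigma_finite "\<lambda>_::'n. lborel :: real measure" ..
  note [measurable] = vec_lambda_measurable
  fix l u :: "real^'n" assume *: "\<And>b. b \<in> Basis \<Longrightarrow> l \<bullet> b \<le> u \<bullet> b"
  have le: "l $ i \<le> u $ i" for i
    using *[of "axis i 1"] by (simp add: inner_axis axis_in_Basis_iff)
  have "vec_lambda -` box l u \<inter> space (\<Pi>\<^sub>M i\<in>(UNIV::'n set). (lborel::real measure))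
      = Pi\<^sub>E UNIV (\<lambda>i. {l $ i <..< u $ i})"
    by (auto simp: space_PiM PiE_def Pi_def mem_box_cart)
  then have "emeasure (distr (\<Pi>\<^sub>M i\<in>UNIV. lborel) borel vec_lambda) (box l u)
     = (\<Prod>i\<in>UNIV. emeasure lborel {l $ i <..< u $ i})"
    by (simp add: emeasure_distr emeasure_PiM)
  also have "\<dots> = ennreal (\<Prod>i\<in>UNIV. u $ i - l $ i)"
    using le by (simp add: prod_ennreal)
  also have "(\<Prod>i\<in>UNIV. u $ i - l $ i) = (\<Prod>b\<in>Basis. (u - l) \<bullet> b)"
  proof -
    have B: "(Basis :: (real^'n) set) = (\<lambda>i. axis i 1) ` UNIV"
      by (auto simp: Basis_vec_def)
    have "inj (\<lambda>i::'n. axis i (1::real))" by (auto simp: inj_on_def axis_eq_axis)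
    then show ?thesis unfolding B by (simp add: prod.reindex inner_axis)
  qed
  finally show "emeasure (distr (\<Pi>\<^sub>M i\<in>UNIV. lborel) borel vec_lambda) (box l u) = ennreal (\<Prod>b\<in>Basis. (u - l) \<bullet> b)" .
qed simp

lemma nn_integral_lborel_vec:
  assumes [measurable]: "h \<in> borel_measurable borel"
  shows "(\<integral>\<^sup>+x. h x \<partial>(lborel :: (real^'n::finite) measure)) = (\<integral>\<^sup>+x. h (vec_lambda x) \<partial>(\<Pi>\<^sub>M i\<in>UNIV. lborel))"
  unfolding lborel_vec_eq by (rule nn_integral_distr[OF vec_lambda_measurable]) (simp add: assms)

text \<open>Integrate over coordinate \<open>j\<close> innermost: \<open>g\<close> ignores that
  coordinate, so the shear acts on each inner integral as a translation of the real line.\<close>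

lemma nn_integral_lborel_shear:
  fixes h :: "real^'n::finite \<Rightarrow> ennreal" and g :: "real^'n \<Rightarrow> real"
  assumes h [measurable]: "h \<in> borel_measurable borel" and g[measurable]: "g \<in> borel_measurable borel"
    and g_indep: "\<And>x t. g (vec_upd x j t) = g x"
    and meas[measurable]: "(\<lambda>x. vec_upd x j (x $ j - g x)) \<in> borel_measurable borel"
  shows "(\<integral>\<^sup>+x. h (vec_upd x j (x $ j - g x)) \<partial>lborel) = (\<integral>\<^sup>+x. h x \<partial>lborel)"
proof -
  interpret product_sigma_finite "\<lambda>_::'n. lborel :: real measure" ..
  note [measurable] = vec_lambda_measurable
  let ?P = "\<Pi>\<^sub>M i\<in>UNIV - {j}. (lborel :: real measure)"
  have split: "(\<integral>\<^sup>+x. k x \<partial>lborel) = (\<integral>\<^sup>+x. \<integral>\<^sup>+y. k (vec_lambda (x(j := y))) \<partial>lborel \<partial>?P)"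
    if [measurable]: "k \<in> borel_measurable borel" for k :: "real^'n \<Rightarrow> ennreal"
  proof -
    have U: "insert j (UNIV - {j}) = UNIV" by auto
    have "(\<lambda>x. k (vec_lambda x)) \<in> borel_measurable (\<Pi>\<^sub>M i\<in>UNIV. lborel)" by measurable
    then have "(\<integral>\<^sup>+x. k (vec_lambda x) \<partial>(\<Pi>\<^sub>M i\<in>UNIV. lborel)) = (\<integral>\<^sup>+x. \<integral>\<^sup>+y. k (vec_lambda (x(j := y))) \<partial>lborel \<partial>?P)"
      using product_nn_integral_insert[where I="UNIV - {j}" and i=j, unfolded U] by simp
    then show ?thesis by (simp add: nn_integral_lborel_vec)
  qed
  have "(\<integral>\<^sup>+y. h (vec_upd (vec_lambda (x(j := y))) j (y - g (vec_lambda (x(j := y))))) \<partial>lborel)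
      = (\<integral>\<^sup>+y. h (vec_lambda (x(j := y))) \<partial>lborel)" (is "?L = ?R") if x: "x \<in> space ?P" for x
  proof -
    \<comment> \<open>The value 0 is a mere placeholder, since \<open>g\<close> ignores coordinate
      \<open>j\<close>.\<close>
    define c where "c = g (vec_lambda (x(j := 0)))"
    have upd: "vec_upd (vec_lambda (x(j := y))) j t = vec_lambda (x(j := t))" for y t
      by (simp add: vec_upd_def vec_eq_iff)
    have c: "g (vec_lambda (x(j := y))) = c" for y
      using g_indep[of "vec_lambda (x(j := 0))" y] unfolding upd c_def .
    have [measurable]: "(\<lambda>y. vec_lambda (x(j := y))) \<in> borel_measurable borel"
    proof -
      have "(\<lambda>y. x(j := y)) \<in> borel \<rightarrow>\<^sub>M (\<Pi>\<^sub>M i\<in>UNIV. lborel)"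
        by (rule measurable_PiM_single') auto
      then show ?thesis by measurable
    qed
    have "?L = (\<integral>\<^sup>+y. h (vec_lambda (x(j := y - c))) \<partial>lborel)"
      by (simp add: c upd)
    also have "\<dots> = ?R"
      by (subst (2) nn_integral_real_affine[where c=1 and t="-c"]) simp_all
    finally show ?thesis .
  qed
  then have "(\<integral>\<^sup>+x. \<integral>\<^sup>+y. h (vec_upd (vec_lambda (x(j := y))) j (y - g (vec_lambda (x(j := y))))) \<partial>lborel \<partial>?P)
      = (\<integral>\<^sup>+x. \<integral>\<^sup>+y. h (vec_lambda (x(j := y))) \<partial>lborel \<partial>?P)"
    by (rule nn_integral_cong)
  moreover have "(\<lambda>x. h (vec_upd x j (x $ j - g x))) \<in> borel_measurable borel"
    using measurable_compose[OF meas h] .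
  ultimately show ?thesis
    using split[OF h] split[of "\<lambda>x. h (vec_upd x j (x $ j - g x))"] by simp
qed

section \<open>Joint density of independent variables\<close>

text \<open>On a rectangle the integral of a product of one-variable functions factors, and by
  sigma-finiteness the values on rectangles determine the product measure.\<close>

lemma PiM_density_eq:
  fixes M :: "'i \<Rightarrow> 'b measure" and g :: "'i \<Rightarrow> 'b \<Rightarrow> ennreal"
  assumes I: "finite I" and "\<And>i. sigma_finite_measure (M i)"
    and "\<And>i. sigma_finite_measure (density (M i) (g i))"
    and g[measurable]: "\<And>i. g i \<in> borel_measurable (M i)"
  shows "(\<Pi>\<^sub>M i\<in>I. density (M i) (g i)) = density (PiM I M) (\<lambda>x. \<Prod>i\<in>I. g i (x i))"
proof (rule sym)
  interpret M: product_sigma_finite M using assms by (simp add: product_sigma_finite_def)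
  interpret D: product_sigma_finite "\<lambda>i. density (M i) (g i)" using assms by (simp add: product_sigma_finite_def)
  show "density (PiM I M) (\<lambda>x. \<Prod>i\<in>I. g i (x i)) = (\<Pi>\<^sub>M i\<in>I. density (M i) (g i))"
  proof (rule D.PiM_eqI[OF I])
    show "sets (density (PiM I M) (\<lambda>x. \<Prod>i\<in>I. g i (x i))) = sets (\<Pi>\<^sub>M i\<in>I. density (M i) (g i))"
      by (simp cong: sets_PiM_cong)
    fix A assume "\<And>i. i \<in> I \<Longrightarrow> A i \<in> sets (density (M i) (g i))"
    then have A[measurable]: "\<And>i. i \<in> I \<Longrightarrow> A i \<in> sets (M i)" by simp
    have [measurable]: "(\<lambda>x. \<Prod>i\<in>I. g i (x i)) \<in> borel_measurable (PiM I M)"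
      using I by (intro borel_measurable_prod_ennreal) measurable
    have "emeasure (density (PiM I M) (\<lambda>x. \<Prod>i\<in>I. g i (x i))) (Pi\<^sub>E I A)
       = (\<integral>\<^sup>+x. (\<Prod>i\<in>I. g i (x i)) * indicator (Pi\<^sub>E I A) x \<partial>PiM I M)"
      using I A by (subst emeasure_density) (auto intro!: sets_PiM_I_finite)
    also have "\<dots> = (\<integral>\<^sup>+x. (\<Prod>i\<in>I. g i (x i) * indicator (A i) (x i)) \<partial>PiM I M)"
    proof (rule nn_integral_cong)
      fix x assume x: "x \<in> space (PiM I M)"
      show "(\<Prod>i\<in>I. g i (x i)) * indicator (Pi\<^sub>E I A) x = (\<Prod>i\<in>I. g i (x i) * indicator (A i) (x i))"
      proof (cases "x \<in> Pi\<^sub>E I A")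
        case True then show ?thesis by (auto intro!: prod.cong simp: PiE_mem)
      next
        case False
        \<comment> \<open>Being extensional, \<open>x\<close> can leave the rectangle only through a
          coordinate in \<open>I\<close>, and the factor of that coordinate is 0.\<close>
        then obtain i where "i \<in> I" "x i \<notin> A i" using x by (auto simp: space_PiM PiE_def)
        then have "(\<Prod>i\<in>I. g i (x i) * indicator (A i) (x i)) = 0"
          using I by (intro prod_zero bexI[of _ i]) auto
        then show ?thesis using False by simp
      qed
    qed
    also have "\<dots> = (\<Prod>i\<in>I. \<integral>\<^sup>+x. g i x * indicator (A i) x \<partial>M i)"
      using I by (intro M.product_nn_integral_prod) measurable
    also have "\<dots> = (\<Prod>i\<in>I. emeasure (density (M i) (g i)) (A i))"
      using A by (intro prod.cong) (auto simp: emeasure_density)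
    finally show "emeasure (density (PiM I M) (\<lambda>x. \<Prod>i\<in>I. g i (x i))) (Pi\<^sub>E I A)
       = (\<Prod>i\<in>I. emeasure (density (M i) (g i)) (A i))" .
  qed
qed

lemma (in prob_space) distributed_vec_indep:
  fixes Y :: "'n::finite \<Rightarrow> 'a \<Rightarrow> real" and g :: "'n \<Rightarrow> real \<Rightarrow> ennreal"
  assumes Y: "\<And>i. distributed M lborel (Y i) (g i)"
    and ind: "indep_vars (\<lambda>_. borel) Y UNIV"
  shows "distributed M lborel (\<lambda>\<omega>. \<chi> i. Y i \<omega>) (\<lambda>y. \<Prod>i\<in>UNIV. g i (y $ i))"
proof -
  let ?P = "\<Pi>\<^sub>M i\<in>(UNIV :: 'n set). (lborel :: real measure)"
  note [measurable] = vec_lambda_measurable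
  have g[measurable]: "g i \<in> borel_measurable borel" for i
    using distributed_borel_measurable[OF Y] by simp
  have Y_meas[measurable]: "Y i \<in> borel_measurable M" for i
    using distributed_measurable[OF Y] by simp
  have sP: "sets (\<Pi>\<^sub>M i\<in>(UNIV :: 'n set). (borel :: real measure)) = sets ?P"
    by (rule sets_PiM_cong) auto
  have D: "distr M borel (Y i) = density lborel (g i)" for i
    using distributed_distr_eq_density[OF Y[of i]] by (simp cong: distr_cong)
  have "distr M ?P (\<lambda>\<omega> i. Y i \<omega>) = distr M (\<Pi>\<^sub>M i\<in>(UNIV :: 'n set). borel) (\<lambda>\<omega>. \<lambda>i\<in>UNIV. Y i \<omega>)"
    using sP by (intro distr_cong) auto
  also have "\<dots> = (\<Pi>\<^sub>M i\<in>UNIV. distr M borel (Y i))"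
    using ind by (subst indep_vars_iff_distr_eq_PiM[symmetric]) auto
  also have "\<dots> = density ?P (\<lambda>x. \<Prod>i\<in>UNIV. g i (x i))"
    unfolding D
  proof (rule PiM_density_eq)
    \<comment> \<open>This density is the law of \<open>Y i\<close>, hence a probability
      measure.\<close>
    show "sigma_finite_measure (density lborel (g i))" for i
      unfolding D[symmetric]
      by (intro prob_space_imp_sigma_finite prob_space_distr) simp
  qed (auto intro: lborel.sigma_finite_measure_axioms)
  finally have E: "distr M ?P (\<lambda>\<omega> i. Y i \<omega>) = density ?P (\<lambda>x. \<Prod>i\<in>UNIV. g i (x i))" .
  have mY[measurable]: "(\<lambda>\<omega> i. Y i \<omega>) \<in> M \<rightarrow>\<^sub>M ?P"
    by (rule measurable_PiM_single') auto
  have vY[measurable]: "(\<lambda>\<omega>. \<chi> i. Y i \<omega>) \<in> borel_measurable M"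
    by measurable
  have "distr M lborel (\<lambda>\<omega>. \<chi> i. Y i \<omega>) = distr (distr M ?P (\<lambda>\<omega> i. Y i \<omega>)) borel vec_lambda"
    by (subst distr_distr) (auto simp: comp_def intro!: distr_cong)
  also have "\<dots> = density lborel (\<lambda>y. \<Prod>i\<in>UNIV. g i (y $ i))"
    unfolding E
    by (subst lborel_vec_eq, subst density_distr) (auto intro!: measure_eqI)
  finally show ?thesis
    by (simp add: distributed_def)
qed

section \<open>From almost everywhere to everywhere\<close>

text \<open>The set where the functions differ is open and null, hence empty.\<close>

lemma continuous_AE_eq_imp_eq:
  fixes g h :: "'a::euclidean_space \<Rightarrow> 'b::t2_space"
  assumes g: "continuous_on UNIV g" and h: "continuous_on UNIV h" and ae: "AE x in lborel. g x = h x"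
  shows "g x = h x"
proof -
  let ?N = "{x. g x \<noteq> h x}"
  have "open ?N" using g h by (intro open_Collect_neq)
  moreover have "?N \<in> null_sets lborel"
    using ae \<open>open ?N\<close> by (subst (asm) AE_iff_null) auto
  then have "negligible ?N"
    by (simp add: negligible_iff_null_sets null_sets_completionI)
  ultimately show ?thesis using open_not_negligible by blast
qed

text \<open>Since \<open>p\<close> is positive, a null set for the law of \<open>X\<close> is a
  Lebesgue null set, so continuity upgrades almost sure constancy to constancy.\<close>

lemma zero_variance_continuous_iff:
  fixes h :: "real^'n::finite \<Rightarrow> real"
  assumes X: "distributed M lborel X (\<lambda>x. ennreal (p x))" and p: "\<And>x. 0 < p x"
    and h: "continuous_on UNIV h"
  shows "zero_variance M (\<lambda>\<omega>. h (X \<omega>)) \<longleftrightarrow> (\<exists>c. \<forall>x. h x = c)"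
proof
  assume "zero_variance M (\<lambda>\<omega>. h (X \<omega>))"
  then obtain c where "AE \<omega> in M. h (X \<omega>) = c" by (auto simp: zero_variance_def)
  moreover have [measurable]: "h \<in> borel_measurable borel"
    using h by (rule borel_measurable_continuous_onI)
  ultimately have "AE x in distr M lborel X. h x = c"
    using distributed_measurable[OF X] by (subst AE_distr_iff) auto
  then have "AE x in lborel. h x = c"
    unfolding distributed_distr_eq_density[OF X]
    using p distributed_borel_measurable[OF X] by (subst (asm) AE_density) auto
  then show "\<exists>c. \<forall>x. h x = c"
    using continuous_AE_eq_imp_eq[OF h continuous_on_const] by blast
qed (auto simp: zero_variance_def)

subsection \<open>The density of an additive noise model\<close>

locale acyclic_additive_model =
  fixes G :: "('n::finite \<times> 'n) set" and f :: "'n \<Rightarrow> real^'n \<Rightarrow> real"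
  assumes acyclic: "acyclic G"
    and coords: "function_of_coords (parents G i) (f i)"
    and f_continuous: "continuous_on UNIV (f i)"
begin

lemma f_measurable [measurable]: "f i \<in> borel_measurable borel"
  using f_continuous by (rule borel_measurable_continuous_onI)

lemma not_self_parent: "j \<notin> parents G j"
  using acyclic by (auto simp: parents_def acyclic_def)

lemma f_cong: "(\<And>k. k \<in> parents G i \<Longrightarrow> x $ k = y $ k) \<Longrightarrow> f i x = f i y"
  using coords[of i] unfolding function_of_coords_def by blast

lemma wf_converse: "wf (G\<inverse>)"
  using acyclic by (intro finite_acyclic_wf_converse) auto

section \<open>The residual map as a composition of shears\<close>

text \<open>The parameter \<open>A\<close> serves an induction over the vertices. For
  \<open>A = UNIV\<close> the model equations say that the map sends \<open>X\<close> to the noise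
  vector.\<close>

definition residual_map :: "'n set \<Rightarrow> real^'n \<Rightarrow> real^'n" where
  "residual_map A x = (\<chi> i. if i \<in> A then x $ i - f i x else x $ i)"

text \<open>Invariance is stated for integrals so that it composes directly; the measurable left
  inverse recovers \<open>X\<close> from the noise.\<close>

definition measure_isomorphic :: "(real^'n \<Rightarrow> real^'n) \<Rightarrow> bool" where
  "measure_isomorphic R \<longleftrightarrow> R \<in> borel_measurable borel \<and>
     (\<forall>h\<in>borel_measurable borel. (\<integral>\<^sup>+x. h (R x) \<partial>lborel) = (\<integral>\<^sup>+x. h x \<partial>lborel)) \<and>
     (\<exists>U\<in>borel_measurable borel. \<forall>x. U (R x) = x)"

text \<open>A parent of \<open>j\<close> in \<open>A\<close> would force \<open>j\<close> into
  \<open>A\<close>, so \<open>residual_map A\<close> leaves the arguments of \<open>f j\<close>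
  untouched. Including \<open>j\<close> is therefore one further shear, undone by adding
  \<open>f j\<close> back.\<close>

lemma measure_isomorphic_residual_map_insert:
  assumes A: "measure_isomorphic (residual_map A)" and closed: "\<And>i k. i \<in> A \<Longrightarrow> (i, k) \<in> G \<Longrightarrow> k \<in> A"
    and j: "j \<notin> A"
  shows "measure_isomorphic (residual_map (insert j A))"
proof -
  let ?S = "\<lambda>y. vec_upd y j (y $ j - f j y)" and ?V = "\<lambda>y. vec_upd y j (y $ j + f j y)"
  have f_upd: "f j (vec_upd y j t) = f j y" for y t
    using not_self_parent by (intro f_cong) (auto simp: vec_upd_component)
  have eq: "residual_map (insert j A) = (\<lambda>x. ?S (residual_map A x))"
  proof
    fix x
    have "f j (residual_map A x) = f j x"
      using closed j by (intro f_cong) (auto simp: residual_map_def parents_def)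
    then show "residual_map (insert j A) x = ?S (residual_map A x)"
      using j by (auto simp: vec_eq_iff vec_upd_component residual_map_def)
  qed
  have S: "?S \<in> borel_measurable borel" and V: "?V \<in> borel_measurable borel"
    by measurable
  obtain U where R: "residual_map A \<in> borel_measurable borel"
    and int: "\<And>h. h \<in> borel_measurable borel \<Longrightarrow> (\<integral>\<^sup>+x. h (residual_map A x) \<partial>lborel) = (\<integral>\<^sup>+x. h x \<partial>lborel)"
    and U: "U \<in> borel_measurable borel" "\<And>x. U (residual_map A x) = x"
    using A by (auto simp: measure_isomorphic_def)
  show ?thesis
    unfolding measure_isomorphic_def eq
  proof (intro conjI ballI)
    show "(\<lambda>x. ?S (residual_map A x)) \<in> borel_measurable borel"
      using measurable_compose[OF R S] .
    fix h :: "real^'n \<Rightarrow> ennreal" assume h: "h \<in> borel_measurable borel"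
    show "(\<integral>\<^sup>+x. h (?S (residual_map A x)) \<partial>lborel) = (\<integral>\<^sup>+x. h x \<partial>lborel)"
      using int[OF measurable_compose[OF S h]] nn_integral_lborel_shear[OF h f_measurable f_upd S] by simp
  next
    have "?V (?S y) = y" for y
      by (auto simp: f_upd vec_eq_iff vec_upd_component)
    then show "\<exists>U\<in>borel_measurable borel. \<forall>x. U (?S (residual_map A x)) = x"
      using measurable_compose[OF V U(1)] U(2) by (intro bexI[of _ "\<lambda>y. U (?V y)"]) auto
  qed
qed

lemma measure_isomorphic_residual_map: "measure_isomorphic (residual_map UNIV)"
proof -
  have "\<exists>A. card A = n \<and> (\<forall>i k. i \<in> A \<longrightarrow> (i, k) \<in> G \<longrightarrow> k \<in> A) \<and> measure_isomorphic (residual_map A)"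
    if "n \<le> CARD('n)" for n
    using that
  proof (induction n)
    case 0
    show ?case
      by (rule exI[of _ "{}"]) (auto simp: measure_isomorphic_def residual_map_def intro!: bexI[of _ "\<lambda>x. x"])
  next
    case (Suc n)
    then obtain A where A: "card A = n" "\<And>i k. i \<in> A \<Longrightarrow> (i, k) \<in> G \<Longrightarrow> k \<in> A"
      "measure_isomorphic (residual_map A)"
      by auto
    with Suc.prems have "A \<noteq> UNIV" by auto
    then obtain i where "i \<in> - A" by auto
    \<comment> \<open>Minimality for the converse of \<open>G\<close> puts all children of
      \<open>j\<close> into \<open>A\<close>, so \<open>insert j A\<close> is again closed under
      children.\<close>
    with wf_converse obtain j where j: "j \<in> - A" "\<And>k. (k, j) \<in> G\<inverse> \<Longrightarrow> k \<notin> - A"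
      by (rule wfE_min) blast
    then show ?case
      using A measure_isomorphic_residual_map_insert[OF A(3) A(2)]
      by (intro exI[of _ "insert j A"]) (auto simp: card_insert_if)
  qed
  from this[of "CARD('n)"] show ?thesis
    using card_eq_UNIV_imp_eq_UNIV[where 'a='n] by (metis finite_class.finite_UNIV order_refl)
qed

text \<open>Almost surely \<open>X\<close> is the left inverse of the residual map applied to the
  noise vector, so its law is an integral against the noise density; a change of variables evaluates
  that density at the residuals.\<close>

lemma distributed_additive_noise:
  fixes X :: "'a \<Rightarrow> real^'n" and \<epsilon> :: "'n \<Rightarrow> 'a \<Rightarrow> real" and g :: "'n \<Rightarrow> real \<Rightarrow> ennreal"
  assumes "prob_space M"
    and noise: "\<And>i. distributed M lborel (\<epsilon> i) (g i)"
    and indep: "prob_space.indep_vars M (\<lambda>_. borel) \<epsilon> UNIV"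
    and model: "AE \<omega> in M. \<forall>i. X \<omega> $ i = f i (X \<omega>) + \<epsilon> i \<omega>"
    and X [measurable]: "X \<in> borel_measurable M"
  shows "distributed M lborel X (\<lambda>x. \<Prod>i\<in>UNIV. g i (x $ i - f i x))"
proof -
  interpret prob_space M by fact
  let ?E = "\<lambda>\<omega>. \<chi> i. \<epsilon> i \<omega>" and ?g = "\<lambda>y::real^'n. \<Prod>i\<in>UNIV. g i (y $ i)"
  let ?R = "residual_map UNIV"
  obtain U where R [measurable]: "?R \<in> borel_measurable borel"
    and int: "\<And>h. h \<in> borel_measurable borel \<Longrightarrow> (\<integral>\<^sup>+x. h (?R x) \<partial>lborel) = (\<integral>\<^sup>+x. h x \<partial>lborel)"
    and U [measurable]: "U \<in> borel_measurable borel" and UR: "\<And>x. U (?R x) = x"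
    using measure_isomorphic_residual_map by (auto simp: measure_isomorphic_def)
  have E: "distributed M lborel ?E ?g"
    using noise indep by (rule distributed_vec_indep)
  have g [measurable]: "?g \<in> borel_measurable borel"
    using distributed_borel_measurable[OF E] by simp
  have gR: "?g (?R x) = (\<Prod>i\<in>UNIV. g i (x $ i - f i x))" for x
    by (simp add: residual_map_def)
  have XE: "AE \<omega> in M. X \<omega> = U (?E \<omega>)"
    using model
  proof eventually_elim
    case (elim \<omega>)
    then have "?R (X \<omega>) = ?E \<omega>"
      by (auto simp: vec_eq_iff residual_map_def algebra_simps)
    then show ?case using UR[of "X \<omega>"] by simp
  qed
  have "distr M lborel X = density lborel (\<lambda>x. ?g (?R x))"
  proof (rule measure_eqI)
    fix A assume "A \<in> sets (distr M lborel X)"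
    then have A [measurable]: "A \<in> sets borel" by simp
    have "emeasure (distr M lborel X) A = (\<integral>\<^sup>+x. indicator A x \<partial>distr M lborel X)"
      by simp
    also have "\<dots> = (\<integral>\<^sup>+\<omega>. indicator A (X \<omega>) \<partial>M)"
      by (rule nn_integral_distr) auto
    also have "\<dots> = (\<integral>\<^sup>+\<omega>. indicator A (U (?E \<omega>)) \<partial>M)"
      using XE by (intro nn_integral_cong_AE) auto
    also have "\<dots> = (\<integral>\<^sup>+y. ?g y * indicator A (U y) \<partial>lborel)"
      by (rule distributed_nn_integral[OF E, symmetric]) measurable
    \<comment> \<open>The substitution \<open>y = ?R x\<close> preserves the integral; afterwards
      \<open>U\<close> is evaluated only at points \<open>?R x\<close>, where it returns
      \<open>x\<close>.\<close>
    also have "\<dots> = (\<integral>\<^sup>+x. ?g (?R x) * indicator A (U (?R x)) \<partial>lborel)"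
      by (rule int[symmetric]) measurable
    also have "\<dots> = emeasure (density lborel (\<lambda>x. ?g (?R x))) A"
      unfolding UR using measurable_compose[OF R g] by (subst emeasure_density) auto
    finally show "emeasure (distr M lborel X) A = emeasure (density lborel (\<lambda>x. ?g (?R x))) A" .
  qed simp
  then show ?thesis
    using measurable_compose[OF R g] by (simp add: distributed_def gR)
qed

end

subsection \<open>The score\<close>

locale additive_gaussian_model = acyclic_additive_model G f
  for G :: "('n::finite \<times> 'n) set" and f :: "'n \<Rightarrow> real^'n \<Rightarrow> real" +
  fixes \<sigma> :: "'n \<Rightarrow> real"
    and D :: "'n \<Rightarrow> real^'n \<Rightarrow> (real^'n) \<Rightarrow>\<^sub>L real"
    and H :: "'n \<Rightarrow> real^'n \<Rightarrow> (real^'n) \<Rightarrow>\<^sub>L (real^'n) \<Rightarrow>\<^sub>L real"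
  assumes D: "(f i has_derivative D i x) (at x)"
    and H: "(D i has_derivative H i x) (at x)"
    and H_continuous: "continuous_on UNIV (H i)"
    and \<sigma>_pos: "\<sigma> i > 0"
begin

lemma D_continuous: "continuous_on UNIV (D i)"
  using H has_derivative_continuous by (blast intro: continuous_at_imp_continuous_on)

section \<open>Derivatives and coordinates that are not parents\<close>

lemma f_translate: "k \<notin> parents G i \<Longrightarrow> f i (x + t *\<^sub>R axis k 1) = f i x"
  by (rule f_cong) (auto simp: axis_def)

lemma f_vec_upd: "k \<notin> parents G i \<Longrightarrow> f i (vec_upd x k t) = f i x"
  unfolding vec_upd_alt by (rule f_translate)

lemma D_translate: "k \<notin> parents G i \<Longrightarrow> D i (x + t *\<^sub>R axis k 1) = D i x"
  using has_derivative_translation_invariant[OF D f_translate] by (simp add: blinfun_apply_inject)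

lemma H_translate: "k \<notin> parents G i \<Longrightarrow> H i (x + t *\<^sub>R axis k 1) = H i x"
  using has_derivative_translation_invariant[OF H D_translate] by (simp add: blinfun_apply_inject)

lemma D_nonparent: "k \<notin> parents G i \<Longrightarrow> D i x (axis k 1) = 0"
proof -
  assume k: "k \<notin> parents G i"
  have "vec_upd x k (x $ k) = x" by (simp add: vec_upd_alt)
  then have "((\<lambda>t. f i x) has_field_derivative D i x (axis k 1)) (at (x $ k))"
    using has_field_derivative_vec_upd[OF D, of i x k "x $ k"] by (simp add: f_vec_upd[OF k])
  then show ?thesis using DERIV_const by (rule DERIV_unique)
qed

text \<open>This fixes the order of the arguments of \<open>H i x\<close>: \<open>v\<close> is the
  direction of the first differentiation, \<open>h\<close> that of the second.\<close>

lemma D_component_has_derivative: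
  "((\<lambda>x. D i x v) has_derivative (\<lambda>h. H i x h v)) (at x)"
  by (auto intro!: derivative_eq_intros H)

lemma H_nonparent: "k \<notin> parents G i \<Longrightarrow> H i x h (axis k 1) = 0"
proof -
  assume k: "k \<notin> parents G i"
  have "((\<lambda>x. 0) has_derivative (\<lambda>h. H i x h (axis k 1))) (at x)"
    using D_component_has_derivative[of i "axis k 1" x] by (simp add: D_nonparent[OF k])
  from has_derivative_unique[OF this has_derivative_const] show ?thesis by (rule fun_cong)
qed

abbreviation residual :: "'n \<Rightarrow> real^'n \<Rightarrow> real" where
  "residual i x \<equiv> x $ i - f i x"

section \<open>The model density and the gradient of its logarithm\<close>

definition model_density :: "real^'n \<Rightarrow> real" where
  "model_density x = (\<Prod>i\<in>UNIV. normal_density 0 (\<sigma> i) (residual i x))"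

lemma model_density_pos: "0 < model_density x"
  unfolding model_density_def using \<sigma>_pos by (intro prod_pos) (auto intro: normal_density_pos)

lemma model_density_continuous: "continuous_on UNIV model_density"
  unfolding model_density_def normal_density_def
  using \<sigma>_pos by (intro continuous_intros f_continuous) (simp_all add: less_imp_neq[symmetric])

lemma ln_model_density:
  "ln (model_density x) = (\<Sum>i\<in>UNIV. - ln (sqrt (2 * pi * (\<sigma> i)\<^sup>2)) - (residual i x)\<^sup>2 / (2 * (\<sigma> i)\<^sup>2))"
  unfolding model_density_def
proof (subst ln_prod)
  show "(\<Sum>i\<in>UNIV. ln (normal_density 0 (\<sigma> i) (residual i x)))
    = (\<Sum>i\<in>UNIV. - ln (sqrt (2 * pi * (\<sigma> i)\<^sup>2)) - (residual i x)\<^sup>2 / (2 * (\<sigma> i)\<^sup>2))"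
  proof (rule sum.cong[OF refl])
    fix i
    have "sqrt (2 * pi * (\<sigma> i)\<^sup>2) > 0" using \<sigma>_pos[of i] by simp
    then show "ln (normal_density 0 (\<sigma> i) (residual i x))
      = - ln (sqrt (2 * pi * (\<sigma> i)\<^sup>2)) - (residual i x)\<^sup>2 / (2 * (\<sigma> i)\<^sup>2)"
      unfolding normal_density_def by (subst ln_mult) (auto simp: ln_div)
  qed
  show "normal_density 0 (\<sigma> i) (residual i x) \<noteq> 0" for i
    using normal_density_pos[OF \<sigma>_pos] by (metis less_irrefl)
qed simp

text \<open>Chain rule for the Gaussian exponents: the inner difference is the partial derivative of
  \<open>residual i\<close> in coordinate \<open>j\<close>.\<close>

definition score_component :: "'n \<Rightarrow> real^'n \<Rightarrow> real" where
  "score_component j x = - (\<Sum>i\<in>UNIV. residual i x * ((if i = j then 1 else 0) - D i x (axis j 1)) / (\<sigma> i)\<^sup>2)"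

lemma vec_eq_sum_axis: "h = (\<Sum>j\<in>UNIV. (h $ j) *\<^sub>R axis j (1::real))" for h :: "real^'n"
  using basis_expansion[of h] by (simp add: scalar_mult_eq_scaleR)

lemma ln_model_density_has_derivative: "((\<lambda>x. ln (model_density x)) has_derivative (\<lambda>h. h \<bullet> (\<chi> j. score_component j x))) (at x)"
proof -
  define L where "L h = - (\<Sum>i\<in>UNIV. residual i x * (h $ i - D i x h) / (\<sigma> i)\<^sup>2)" for h
  have L: "((\<lambda>x. ln (model_density x)) has_derivative L) (at x)"
    unfolding ln_model_density L_def
    by (rule derivative_eq_intros D bounded_linear.has_derivative[OF bounded_linear_vec_nth] refl)+
      (use \<sigma>_pos in \<open>auto simp: sum_negf[symmetric] field_simps less_imp_neq[symmetric] intro!: sum.cong\<close>)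
  moreover have "L = (\<lambda>h. h \<bullet> (\<chi> j. score_component j x))"
  proof
    fix h :: "real^'n"
    \<comment> \<open>A linear functional is determined by its values on the axis vectors, and those
      of \<open>L\<close> are the score components.\<close>
    have "linear L"
      by (rule bounded_linear.linear) (rule has_derivative_bounded_linear[OF L])
    then have "L h = (\<Sum>j\<in>UNIV. h $ j * L (axis j 1))"
      by (subst vec_eq_sum_axis[of h]) (simp only: linear_sum linear_scale real_scaleR_def)
    also have "\<dots> = h \<bullet> (\<chi> j. score_component j x)"
      by (simp add: inner_vec_def score_component_def L_def axis_component)
    finally show "L h = h \<bullet> (\<chi> j. score_component j x)" .
  qed
  ultimately show ?thesis by simp
qed

lemma score_model_density: "score model_density x $ j = score_component j x"
proof -
  have G: "GDERIV (\<lambda>x. ln (model_density x)) x :> (\<chi> j. score_component j x)"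
    using ln_model_density_has_derivative by (simp add: gderiv_def)
  have "gradient (\<lambda>x. ln (model_density x)) x = (\<chi> j. score_component j x)"
    unfolding gradient_def
  proof (rule the_equality)
    show "GDERIV (\<lambda>x. ln (model_density x)) x :> (\<chi> j. score_component j x)" by (rule G)
    fix d assume "GDERIV (\<lambda>x. ln (model_density x)) x :> d"
    then have "(\<lambda>h. h \<bullet> d) = (\<lambda>h. h \<bullet> (\<chi> j. score_component j x))"
      using G unfolding gderiv_def by (rule has_derivative_unique)
    then show "d = (\<chi> j. score_component j x)"
      by (metis vector_eq_ldot)
  qed
  then show ?thesis by (simp add: score_def)
qed

section \<open>Derivatives of the score\<close>

text \<open>Product rule in each summand of \<open>score_component j\<close>. At
  \<open>h = axis i 1\<close> this is an entry of the Hessian of the log density.\<close>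

definition score_deriv :: "'n \<Rightarrow> real^'n \<Rightarrow> real^'n \<Rightarrow> real" where
  "score_deriv j x h = - (\<Sum>i\<in>UNIV. ((h $ i - D i x h) * ((if i = j then 1 else 0) - D i x (axis j 1))
      - residual i x * H i x h (axis j 1)) / (\<sigma> i)\<^sup>2)"

lemma score_component_has_derivative: "(score_component j has_derivative score_deriv j x) (at x)"
proof -
  have "((\<lambda>x. residual i x * (c - D i x v) / s) has_derivative
      (\<lambda>h. ((h $ i - D i x h) * (c - D i x v) - residual i x * H i x h v) / s)) (at x)" for i c v and s :: real
  proof -
    have "((\<lambda>x. residual i x) has_derivative (\<lambda>h. h $ i - D i x h)) (at x)"
      by (intro has_derivative_diff D bounded_linear.has_derivative[OF bounded_linear_vec_nth] has_derivative_ident)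
    moreover have "((\<lambda>x. c - D i x v) has_derivative (\<lambda>h. 0 - H i x h v)) (at x)"
      by (intro has_derivative_diff has_derivative_const D_component_has_derivative)
    ultimately have "((\<lambda>x. residual i x * (c - D i x v)) has_derivative
      (\<lambda>h. residual i x * (0 - H i x h v) + (h $ i - D i x h) * (c - D i x v))) (at x)"
      by (rule has_derivative_mult)
    from bounded_linear.has_derivative[OF bounded_linear_divide this, of s] show ?thesis
      by (simp add: algebra_simps)
  qed
  then show ?thesis
    unfolding score_component_def score_deriv_def by (intro has_derivative_minus has_derivative_sum)
qed

lemma score_deriv_continuous: "continuous_on UNIV (\<lambda>x. score_deriv j x h)"
  unfolding score_deriv_def using \<sigma>_pos
  by (intro continuous_intros blinfun.continuous_on f_continuous D_continuous H_continuous)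
    (simp_all add: less_imp_neq[symmetric])

lemma partial_deriv_score_component: "partial_deriv i (score_component j) x = score_deriv j x (axis i 1)"
  using score_component_has_derivative by (rule partial_deriv_eq)

text \<open>A leaf is a parent of no vertex, so every \<open>D i x (axis j 1)\<close> vanishes and
  only the summand \<open>i = j\<close> survives.\<close>

lemma score_component_leaf:
  assumes "leaf G j"
  shows "score_component j x = (f j x - x $ j) / (\<sigma> j)\<^sup>2"
proof -
  have "j \<notin> parents G i" for i using assms by (auto simp: leaf_def parents_def)
  then show ?thesis by (simp add: score_component_def D_nonparent if_distrib if_distribR minus_divide_left cong: if_cong)
qed

lemma score_deriv_leaf:
  assumes "leaf G j"
  shows "score_deriv j x h = (D j x h - h $ j) / (\<sigma> j)\<^sup>2"
proof -
  have "j \<notin> parents G i" for i using assms by (auto simp: leaf_def parents_def)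
  then show ?thesis by (simp add: score_deriv_def D_nonparent H_nonparent if_distrib if_distribR minus_divide_left cong: if_cong)
qed

lemma score_deriv_diag_leaf: "leaf G j \<Longrightarrow> score_deriv j x (axis j 1) = - 1 / (\<sigma> j)\<^sup>2"
  using not_self_parent by (simp add: score_deriv_leaf D_nonparent)

section \<open>The leaf criterion\<close>

text \<open>Take a child of \<open>j\<close> that is minimal for the converse of \<open>G\<close>:
  none of its own children is a child of \<open>j\<close>.\<close>

lemma obtain_youngest_child:
  assumes "\<not> leaf G j"
  obtains k where "j \<in> parents G k" "\<And>i. j \<in> parents G i \<Longrightarrow> k \<notin> parents G i"
proof -
  from assms obtain i where "i \<in> {i. (j, i) \<in> G}" by (auto simp: leaf_def)
  with wf_converse show ?thesis
    by (rule wfE_min) (use that in \<open>auto simp: parents_def\<close>)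
qed

text \<open>As \<open>k\<close> is a parent of no child of \<open>j\<close>, moving coordinate
  \<open>k\<close> by 1 leaves \<open>f i\<close>, \<open>D i\<close> and \<open>H i\<close>
  unchanged for all these children. Only the residual of \<open>k\<close> itself changes, by 1,
  which isolates one second derivative.\<close>

lemma score_deriv_youngest_child:
  assumes k: "j \<in> parents G k" "\<And>i. j \<in> parents G i \<Longrightarrow> k \<notin> parents G i"
  shows "score_deriv j (x + axis k 1) (axis j 1) - score_deriv j x (axis j 1) = H k x (axis j 1) (axis j 1) / (\<sigma> k)\<^sup>2"
proof -
  let ?T = "\<lambda>x i. ((axis j 1 $ i - D i x (axis j 1)) * ((if i = j then 1 else 0) - D i x (axis j 1))
      - residual i x * H i x (axis j 1) (axis j 1)) / (\<sigma> i)\<^sup>2"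
  have T: "?T x i - ?T (x + axis k 1) i = (if i = k then H k x (axis j 1) (axis j 1) / (\<sigma> k)\<^sup>2 else 0)" for i
  proof (cases "j \<in> parents G i")
    case True
    then have *: "k \<notin> parents G i" by (rule k)
    have "f i (x + axis k 1) = f i x" "D i (x + axis k 1) = D i x" "H i (x + axis k 1) = H i x"
      using f_translate[OF *, of x 1] D_translate[OF *, of x 1] H_translate[OF *, of x 1] by simp_all
    then show ?thesis
      by (simp add: axis_def diff_divide_distrib[symmetric] algebra_simps)
  next
    case False
    \<comment> \<open>Here all derivatives of \<open>f i\<close> along \<open>j\<close> vanish, so
      the summand is the same at both points; \<open>i = k\<close> is excluded.\<close>
    then show ?thesis using k(1) by (auto simp: D_nonparent H_nonparent)
  qed
  have "score_deriv j (x + axis k 1) (axis j 1) - score_deriv j x (axis j 1) = (\<Sum>i\<in>UNIV. ?T x i - ?T (x + axis k 1) i)"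
    unfolding score_deriv_def sum_subtractf by simp
  also have "\<dots> = H k x (axis j 1) (axis j 1) / (\<sigma> k)\<^sup>2"
    unfolding T by simp
  finally show ?thesis .
qed

text \<open>For a non-leaf, constancy would make the difference at the youngest child
  \<open>k\<close> vanish, so \<open>f k\<close> would be affine on every line in direction
  \<open>j\<close>.\<close>

lemma leaf_iff_score_deriv_const:
  assumes nonlinear: "\<And>i. nonlinear_in_every_component (parents G i) (f i)"
  shows "leaf G j \<longleftrightarrow> (\<exists>c. \<forall>x. score_deriv j x (axis j 1) = c)"
proof
  assume "\<exists>c. \<forall>x. score_deriv j x (axis j 1) = c"
  then obtain c where c: "\<And>x. score_deriv j x (axis j 1) = c" by auto
  show "leaf G j"
  proof (rule ccontr)
    assume "\<not> leaf G j"
    then obtain k where k: "j \<in> parents G k" "\<And>i. j \<in> parents G i \<Longrightarrow> k \<notin> parents G i"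
      by (rule obtain_youngest_child) blast
    have H0: "H k x (axis j 1) (axis j 1) = 0" for x
      using score_deriv_youngest_child[OF k, of x] \<sigma>_pos[of k] by (simp add: c)
    obtain x where x: "\<not> (\<exists>\<alpha> \<beta>. \<forall>t. f k (vec_upd x j t) = \<alpha> * t + \<beta>)"
      using nonlinear[of k] k(1) unfolding nonlinear_in_every_component_def by blast
    have "((\<lambda>t. D k (vec_upd x j t) (axis j 1)) has_field_derivative 0) (at t)" for t
      using has_field_derivative_vec_upd[OF D_component_has_derivative[of k "axis j 1" "vec_upd x j t"]] by (simp add: H0)
    then have "D k (vec_upd x j t) (axis j 1) = D k (vec_upd x j 0) (axis j 1)" for t
      by (rule DERIV_isconst_all[rule_format])
    from affine_along_coordinate[OF D this] x show False by blast
  qed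
qed (auto simp: score_deriv_diag_leaf)

section \<open>The parent criterion for a leaf\<close>

text \<open>For a leaf \<open>j\<close> and \<open>i \<noteq> j\<close>, coordinate \<open>i\<close>
  enters \<open>score_component j\<close> only through \<open>f j\<close>.\<close>

lemma parent_iff_score_depends:
  assumes nonlinear: "nonlinear_in_every_component (parents G j) (f j)" and j: "leaf G j" and "i \<noteq> j"
  shows "i \<in> parents G j \<longleftrightarrow> depends_on_coord (score_component j) i"
proof
  assume "i \<in> parents G j"
  then obtain x where x: "\<not> (\<exists>\<alpha> \<beta>. \<forall>t. f j (vec_upd x i t) = \<alpha> * t + \<beta>)"
    using nonlinear unfolding nonlinear_in_every_component_def by blast
  \<comment> \<open>A function constant along the line would be affine with slope 0.\<close>
  then have "\<not> (\<forall>t. f j (vec_upd x i t) = 0 * t + f j x)" by blast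
  then obtain t where "f j (vec_upd x i t) \<noteq> f j x" by auto
  then have "score_component j (vec_upd x i t) \<noteq> score_component j x"
    using \<sigma>_pos[of j] \<open>i \<noteq> j\<close> by (simp add: score_component_leaf[OF j] vec_upd_component)
  then show "depends_on_coord (score_component j) i"
    unfolding depends_on_coord_def by blast
next
  assume "depends_on_coord (score_component j) i"
  then obtain x t where xt: "score_component j (vec_upd x i t) \<noteq> score_component j x" unfolding depends_on_coord_def by blast
  show "i \<in> parents G j"
  proof (rule ccontr)
    assume "i \<notin> parents G j"
    with xt \<open>i \<noteq> j\<close> show False by (simp add: score_component_leaf[OF j] vec_upd_component f_vec_upd)
  qed
qed

text \<open>A constant derivative \<open>c\<close> would make \<open>f j\<close> affine with slope
  \<open>c * (\<sigma> j)\<^sup>2\<close> on every line in direction \<open>i\<close>; for a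
  non-parent the derivative is 0.\<close>

lemma parent_iff_score_deriv_not_const:
  assumes nonlinear: "nonlinear_in_every_component (parents G j) (f j)" and j: "leaf G j" and "i \<noteq> j"
  shows "i \<in> parents G j \<longleftrightarrow> \<not> (\<exists>c. \<forall>x. score_deriv j x (axis i 1) = c)"
proof -
  have eq: "score_deriv j x (axis i 1) = D j x (axis i 1) / (\<sigma> j)\<^sup>2" for x
    using \<open>i \<noteq> j\<close> by (simp add: score_deriv_leaf[OF j] axis_def)
  have False if i: "i \<in> parents G j" and c: "\<And>x. score_deriv j x (axis i 1) = c" for c
  proof -
    obtain x where x: "\<not> (\<exists>\<alpha> \<beta>. \<forall>t. f j (vec_upd x i t) = \<alpha> * t + \<beta>)"
      using nonlinear i unfolding nonlinear_in_every_component_def by blast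
    have "D j (vec_upd x i t) (axis i 1) = c * (\<sigma> j)\<^sup>2" for t
      using c[of "vec_upd x i t"] \<sigma>_pos[of j] by (simp add: eq field_simps)
    from affine_along_coordinate[OF D this] x show False by blast
  qed
  moreover have "\<exists>c. \<forall>x. score_deriv j x (axis i 1) = c" if "i \<notin> parents G j"
    using that by (simp add: eq D_nonparent)
  ultimately show ?thesis by blast
qed

end

theorem lemma1:
  fixes M :: "'a measure"
    and G :: "('n::finite \<times> 'n) set"
    and X :: "'a \<Rightarrow> real^'n"
    and \<epsilon> :: "'n \<Rightarrow> 'a \<Rightarrow> real"
    and \<sigma> :: "'n \<Rightarrow> real"
    and f :: "'n \<Rightarrow> real^'n \<Rightarrow> real"
    and p :: "real^'n \<Rightarrow> real"
  assumes "prob_space M"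
    and "acyclic G"
    and "\<And>i. \<sigma> i > 0"
    and "\<And>i. distributed M lborel (\<epsilon> i) (\<lambda>e. ennreal (normal_density 0 (\<sigma> i) e))"
    and "prob_space.indep_vars M (\<lambda>_. borel) \<epsilon> UNIV"
    and "\<And>i. function_of_coords (parents G i) (f i)"
    and "\<And>i. twice_continuously_differentiable (f i)"
    and "\<And>i. nonlinear_in_every_component (parents G i) (f i)"
    and "AE \<omega> in M. \<forall>i. X \<omega> $ i = f i (X \<omega>) + \<epsilon> i \<omega>"
    and "continuous_density M X p"
  shows
    \<comment> \<open>the score and its partial derivatives exist everywhere\<close>
    "((\<forall>x. 0 < p x \<and> (\<lambda>y. ln (p y)) differentiable (at x)) \<and>
      (\<forall>j x. (\<lambda>y. score p y $ j) differentiable (at x))) \<and>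
     (\<forall>j.
       (leaf G j \<longleftrightarrow> (\<exists>c. \<forall>x. partial_deriv j (\<lambda>y. score p y $ j) x = c)) \<and>
       (leaf G j \<longleftrightarrow> zero_variance M (\<lambda>\<omega>. partial_deriv j (\<lambda>y. score p y $ j) (X \<omega>))) \<and>
       (leaf G j \<longrightarrow> (\<forall>i. i \<noteq> j \<longrightarrow>
          (i \<in> parents G j \<longleftrightarrow> depends_on_coord (\<lambda>y. score p y $ j) i) \<and>
          (i \<in> parents G j \<longleftrightarrow>
             \<not> zero_variance M (\<lambda>\<omega>. partial_deriv i (\<lambda>y. score p y $ j) (X \<omega>))))))"
proof -
  from \<open>\<And>i. twice_continuously_differentiable (f i)\<close> obtain D H where
    D: "\<And>i x. (f i has_derivative blinfun_apply (D i x)) (at x)" and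
    H: "\<And>i x. (D i has_derivative blinfun_apply (H i x)) (at x)" and
    H_cont: "\<And>i. continuous_on UNIV (H i)"
    unfolding twice_continuously_differentiable_def by metis
  have "continuous_on UNIV (f i)" for i
    using D has_derivative_continuous by (blast intro: continuous_at_imp_continuous_on)
  then interpret additive_gaussian_model G f \<sigma> D H
    using assms D H H_cont by unfold_locales auto
  have p_nonneg: "\<And>x. 0 \<le> p x" and p_cont: "continuous_on UNIV p"
    and X: "distributed M lborel X (\<lambda>x. ennreal (p x))"
    using \<open>continuous_density M X p\<close> by (auto simp: continuous_density_def)
  have X_meas: "X \<in> borel_measurable M"
    using distributed_measurable[OF X] by simp
  have prod_eq: "(\<Prod>i\<in>UNIV. ennreal (normal_density 0 (\<sigma> i) (x $ i - f i x))) = ennreal (model_density x)" for x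
    by (simp add: model_density_def prod_ennreal)
  have X': "distributed M lborel X (\<lambda>x. ennreal (model_density x))"
    using distributed_additive_noise[OF assms(1,4,5,9) X_meas] by (simp add: prod_eq)
  have p_eq: "p = model_density"
  proof
    fix x
    \<comment> \<open>Densities of one law agree almost everywhere; continuity of both then
      identifies the given \<open>p\<close> with \<open>model_density\<close>.\<close>
    have "AE x in lborel. ennreal (p x) = ennreal (model_density x)"
      using X X' by (intro sigma_finite_measure.density_unique[OF lborel.sigma_finite_measure_axioms]) (auto simp: distributed_def)
    then have "AE x in lborel. p x = model_density x"
      using p_nonneg model_density_pos by (auto simp: less_imp_le)
    then show "p x = model_density x"
      by (rule continuous_AE_eq_imp_eq[OF p_cont model_density_continuous])
  qed
  \<comment> \<open>Every claim about variance thus becomes one about constancy of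
    \<open>score_deriv\<close>, which the two criteria decide.\<close>
  have zero_var: "zero_variance M (\<lambda>\<omega>. score_deriv j (X \<omega>) h) \<longleftrightarrow> (\<exists>c. \<forall>x. score_deriv j x h = c)" for j h
    by (rule zero_variance_continuous_iff[OF X' model_density_pos score_deriv_continuous])
  have "(\<lambda>y. ln (model_density y)) differentiable at x" for x
    using ln_model_density_has_derivative unfolding differentiable_def by blast
  moreover have "score_component j differentiable at x" for j x
    using score_component_has_derivative unfolding differentiable_def by blast
  ultimately show ?thesis
    unfolding p_eq score_model_density partial_deriv_score_component zero_var
    using model_density_pos leaf_iff_score_deriv_const[OF assms(8)]
      parent_iff_score_depends[OF assms(8)] parent_iff_score_deriv_not_const[OF assms(8)]
    by simp
qed

end
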